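(* Let $w \in \mathbb{N}^*$. Let $\mathrm{supp}(w) = \{x_1,\dots,x_k\}$ be such that $\overrightarrow{\rho_{w}}(x_i) < \overrightarrow{\rho_{w}}(x_{i+1})$ for all $1 \leq i < k$. Then there are $$\frac{|w|!}{\prod_{i=1}^k \left((|w|_{x_i}-1)!\, \sum_{j=i}^k |w|_{x_j}\right)}$$ words over $\mathbb{N}$ in the $\equiv_{\mathrm{lSt}}$-class of $w$.
   Context: $\mathbb{N}=\{1,2,\dots\}$ and $\mathbb{N}^*$ is the free monoid of words over $\mathbb{N}$. $|w|$ is the length of $w$, $|w|_x$ the number of occurrences of the letter $x$ in $w$, $\mathrm{supp}(w)$ the set of letters occurring in $w$, and $\overrightarrow{\rho_w}:\mathrm{supp}(w)\to\{1,\dots,|\mathrm{supp}(w)|\}$ sends a letter to its rank when the letters of $w$ are ordered by the position of their first occurrence, reading left to right. The left-stalactic congruence $\equiv_{\mathrm{lSt}}$ on $\mathbb{N}^*$ is the congruence generated by the pairs $(b\,u\,ab,\ b\,u\,ba)$ with $a,b\in\mathbb{N}$, $u\in\mathbb{N}^*$; equivalently, $u\equiv_{\mathrm{lSt}}v$ iff $|u|_x=|v|_x$ for all letters $x$ and $\overrightarrow{\rho_u}=\overrightarrow{\rho_v}$. *)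

theory Defs
  imports Complex_Main
begin

text \<open>The letters are the positive integers, so \<open>\<nat>\<^sup>*\<close> is the set of lists over \<open>{1..}\<close>.\<close>

definition nwords :: "nat list set" where
  "nwords = lists {1..}"

definition first_pos :: "'a list \<Rightarrow> 'a \<Rightarrow> nat" where
  "first_pos w x = (LEAST i. i < length w \<and> w ! i = x)"

text \<open>Only meaningful for \<open>x \<in> set w\<close>; there it takes values in \<open>{1..card (set w)}\<close>.\<close>

definition first_rank :: "'a list \<Rightarrow> 'a \<Rightarrow> nat" where
  "first_rank w x = card {y \<in> set w. first_pos w y \<le> first_pos w x}"

text \<open>The least congruence on the monoid \<open>nwords\<close> that contains the pairs of \<open>gen\<close>;
  it relates only elements of \<open>nwords\<close>.\<close>

inductive lst_cong :: "nat list \<Rightarrow> nat list \<Rightarrow> bool" where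
  gen: "\<lbrakk>a \<ge> 1; b \<ge> 1; u \<in> nwords\<rbrakk> \<Longrightarrow> lst_cong ([b] @ u @ [a, b]) ([b] @ u @ [b, a])"
| refl: "u \<in> nwords \<Longrightarrow> lst_cong u u"
| sym: "lst_cong u v \<Longrightarrow> lst_cong v u"
| trans: "\<lbrakk>lst_cong u v; lst_cong v w\<rbrakk> \<Longrightarrow> lst_cong u w"
| mult: "\<lbrakk>lst_cong u v; lst_cong u' v'\<rbrakk> \<Longrightarrow> lst_cong (u @ u') (v @ v')"

end

theory Submission
  imports Defs "HOL-Library.Multiset"
begin

text \<open>A word is determined up to the congruence by its letter multiplicities and by the list of its
  letters in order of first occurrence: a repeated letter can be moved left to the block of its
  first occurrence, so \<open>u\<close> is congruent to the product of the powers of its letters in that order.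
  Such words are counted by recursion on the list of letters: a word whose first letter is \<open>y\<close> is
  \<open>y\<close> followed by a shuffle of the remaining occurrences of \<open>y\<close> with a word over the other letters,
  which gives a binomial coefficient at each step.\<close>

section \<open>Order of first occurrence\<close>

primrec first_occs :: "'a list \<Rightarrow> 'a list" where
  "first_occs [] = []"
| "first_occs (a # u) = a # filter (\<lambda>y. y \<noteq> a) (first_occs u)"

lemma set_first_occs [simp]: "set (first_occs u) = set u"
  by (induction u) auto

lemma distinct_first_occs: "distinct (first_occs u)"
  by (induction u) auto

lemma first_occs_eq_Nil_iff [simp]: "first_occs u = [] \<longleftrightarrow> u = []"
  by (cases u) auto

lemma first_occs_filter: "first_occs (filter P u) = filter P (first_occs u)"
  by (induction u) (auto intro!: filter_cong)

lemma first_occs_append: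
  "first_occs (u @ v) = first_occs u @ filter (\<lambda>y. y \<notin> set u) (first_occs v)"
  by (induction u) (auto intro!: filter_cong)

lemma count_list_filter: "count_list (filter P u) z = (if P z then count_list u z else 0)"
  by (induction u) auto

lemma count_list_replicate: "count_list (replicate n y) z = (if z = y then n else 0)"
  by (induction n) auto

lemma filter_eq_replicate_count_list: "filter (\<lambda>z. z = y) u = replicate (count_list u y) y"
  by (induction u) auto

text \<open>As \<open>y\<close> does not occur in \<open>v\<close>, these shuffles are a fibre of
  \<open>partition\<close>, so \<open>v\<close> can be recovered from any of them. This later makes
  the shuffle sets for different \<open>v\<close> disjoint.\<close>

lemma filter_shuffles_replicate:
  assumes "y \<notin> set v" "u \<in> shuffles (replicate n y) v"
  shows "filter (\<lambda>z. z \<noteq> y) u = v"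
proof -
  have "partition (\<lambda>z. z = y) -` {(replicate n y, v)} = shuffles (replicate n y) v"
    using assms(1) by (intro inv_image_partition) auto
  with assms(2) show ?thesis by (auto simp: o_def)
qed

lemma first_pos_Cons_self: "first_pos (a # u) a = 0"
  unfolding first_pos_def by (rule Least_equality) auto

lemma first_pos_Cons_other:
  assumes "y \<in> set u" "y \<noteq> a"
  shows "first_pos (a # u) y = Suc (first_pos u y)"
proof -
  from assms(1) obtain i where "i < length u" "u ! i = y"
    by (auto simp: in_set_conv_nth)
  then have "Suc i < length (a # u) \<and> (a # u) ! Suc i = y" by simp
  then show ?thesis
    unfolding first_pos_def
    by (subst Least_Suc[where n = "Suc i"]) (use assms(2) in auto)
qed

lemma sorted_first_occs: "sorted_wrt (\<lambda>y z. first_pos u y < first_pos u z) (first_occs u)"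
proof (induction u)
  case (Cons a u)
  have "sorted_wrt (\<lambda>y z. first_pos (a # u) y < first_pos (a # u) z)
      (filter (\<lambda>y. y \<noteq> a) (first_occs u))"
    by (rule sorted_wrt_mono_rel[OF _ sorted_wrt_filter[OF Cons.IH]])
       (auto simp: first_pos_Cons_other)
  then show ?case
    by (auto simp: first_pos_Cons_self first_pos_Cons_other)
qed simp

lemma first_pos_less_of_first_rank_less:
  assumes "first_rank u y < first_rank u z"
  shows "first_pos u y < first_pos u z"
proof (rule ccontr)
  assume "\<not> first_pos u y < first_pos u z"
  then have "first_rank u z \<le> first_rank u y"
    unfolding first_rank_def by (intro card_mono) auto
  with assms show False by simp
qed

text \<open>Both lists have the same letters and are strictly increasing under
  \<open>first_pos u\<close>, so their images agree, and \<open>first_pos u\<close> is injective on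
  the letters of \<open>u\<close>. This turns an enumeration of the support by rank into
  \<open>first_occs\<close>.\<close>

lemma first_occs_eqI:
  assumes "set xs = set u" and "sorted_wrt (\<lambda>y z. first_pos u y < first_pos u z) xs"
  shows "first_occs u = xs"
proof -
  let ?p = "first_pos u"
  have s: "sorted_wrt (<) (map ?p (first_occs u))" "sorted_wrt (<) (map ?p xs)"
    using assms(2) sorted_first_occs[of u] by (auto simp: sorted_wrt_map)
  have eq: "map ?p (first_occs u) = map ?p xs"
    by (rule strict_sorted_equal) (use s assms(1) in auto)
  have "inj_on ?p (set (first_occs u))"
    using s(1) by (simp add: strict_sorted_iff distinct_map)
  then show ?thesis
    using eq assms(1) by (intro map_inj_on[OF eq]) simp
qed

section \<open>Invariants and normal form of the congruence\<close>

lemma nwords_simps [simp]: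
  "[] \<in> nwords" "a # u \<in> nwords \<longleftrightarrow> a \<ge> 1 \<and> u \<in> nwords"
  "u @ v \<in> nwords \<longleftrightarrow> u \<in> nwords \<and> v \<in> nwords"
  by (auto simp: nwords_def)

lemma nwords_filter: "u \<in> nwords \<Longrightarrow> filter P u \<in> nwords"
  by (auto simp: nwords_def)

lemma nwords_replicate: "a \<ge> 1 \<Longrightarrow> replicate n a \<in> nwords"
  by (auto simp: nwords_def)

text \<open>In a generating pair the letter \<open>b\<close> has already been seen at the front, so
  swapping it with \<open>a\<close> does not affect the order of first occurrences.\<close>

lemma lst_cong_invariants:
  assumes "lst_cong u v"
  shows "u \<in> nwords \<and> v \<in> nwords \<and> mset u = mset v \<and> first_occs u = first_occs v"
  using assms
proof induction
  case (gen a b u)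
  then show ?case by (auto simp: first_occs_append)
next
  case (mult u v u' v')
  then have "set u = set v" by (metis set_mset_mset)
  with mult show ?case by (simp add: first_occs_append)
qed auto

text \<open>The leading \<open>b\<close> allows the last \<open>b\<close> to be swapped with its
  left neighbour by a generator; induction from the right end of \<open>u\<close> carries it through
  the whole word.\<close>

lemma lst_cong_move_left:
  assumes "b \<ge> 1" "u \<in> nwords"
  shows "lst_cong (b # u @ [b]) (b # b # u)"
  using assms(2)
proof (induction u rule: rev_induct)
  case Nil
  then show ?case using assms(1) by (auto intro: lst_cong.refl)
next
  case (snoc c u)
  then have "lst_cong (b # u @ [c, b]) (b # u @ [b, c])"
    using lst_cong.gen[of c b u] assms(1) by simp
  moreover have "lst_cong ((b # u @ [b]) @ [c]) ((b # b # u) @ [c])"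
    using snoc by (intro lst_cong.mult lst_cong.refl) auto
  ultimately show ?case
    using lst_cong.trans by fastforce
qed

lemma lst_cong_gather:
  assumes "a \<ge> 1" "u \<in> nwords"
  shows "lst_cong (a # u) (replicate (count_list (a # u) a) a @ filter (\<lambda>y. y \<noteq> a) u)"
  using assms(2)
proof (induction u rule: rev_induct)
  case Nil
  then show ?case using assms(1) by (auto intro: lst_cong.refl)
next
  case (snoc c u)
  let ?v = "replicate (count_list u a) a @ filter (\<lambda>y. y \<noteq> a) u"
  have "lst_cong ((a # u) @ [c]) ((a # ?v) @ [c])"
    using snoc by (intro lst_cong.mult lst_cong.refl) auto
  \<comment> \<open>This handles \<open>c = a\<close>: the new occurrence travels left to the block.
    Any other \<open>c\<close> just stays at the end.\<close>
  moreover have "lst_cong (a # ?v @ [a]) (a # a # ?v)"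
    using assms(1) snoc.prems
    by (intro lst_cong_move_left) (auto simp: nwords_filter nwords_replicate)
  ultimately show ?case
    using lst_cong.trans by fastforce
qed

text \<open>The target depends only on the counts and on \<open>first_occs u\<close>, so words
  sharing these data are congruent; this is the converse of the invariance. Gathering the first
  letter leaves a word without it, to which induction applies.\<close>

lemma lst_cong_normal_form:
  assumes "u \<in> nwords" "first_occs u = xs"
  shows "lst_cong u (concat (map (\<lambda>y. replicate (count_list u y) y) xs))"
  using assms
proof (induction xs arbitrary: u)
  case Nil
  then show ?case by (auto intro: lst_cong.refl)
next
  case (Cons a xs)
  from Cons.prems(2) obtain u' where u: "u = a # u'" "xs = filter (\<lambda>y. y \<noteq> a) (first_occs u')"
    by (cases u) auto
  let ?v = "filter (\<lambda>y. y \<noteq> a) u'"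
  have a: "a \<ge> 1" "u' \<in> nwords" using Cons.prems u by auto
  have "lst_cong ?v (concat (map (\<lambda>y. replicate (count_list ?v y) y) xs))"
    using a u by (intro Cons.IH) (auto simp: first_occs_filter nwords_filter)
  moreover have "map (\<lambda>y. replicate (count_list ?v y) y) xs = map (\<lambda>y. replicate (count_list u y) y) xs"
    using u by (auto simp: count_list_filter)
  ultimately have "lst_cong ?v (concat (map (\<lambda>y. replicate (count_list u y) y) xs))"
    by simp
  then have "lst_cong (replicate (count_list u a) a @ ?v)
      (replicate (count_list u a) a @ concat (map (\<lambda>y. replicate (count_list u y) y) xs))"
    using a by (intro lst_cong.mult lst_cong.refl) (auto simp: nwords_replicate)
  with lst_cong_gather[OF a] show ?case
    using u(1) lst_cong.trans by fastforce
qed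

lemma lst_cong_iff:
  assumes "w \<in> nwords"
  shows "lst_cong w u \<longleftrightarrow>
    first_occs u = first_occs w \<and> (\<forall>y\<in>set (first_occs w). count_list u y = count_list w y)"
    (is "_ \<longleftrightarrow> ?R")
proof
  assume "lst_cong w u"
  then show ?R
    using lst_cong_invariants[of w u] by (metis count_mset)
next
  assume R: ?R
  then have "set u = set w" by (metis set_first_occs)
  then have u: "u \<in> nwords" using assms by (auto simp: nwords_def lists_eq_set)
  have "map (\<lambda>y. replicate (count_list u y) y) (first_occs w)
      = map (\<lambda>y. replicate (count_list w y) y) (first_occs w)"
    using R by auto
  then show "lst_cong w u"
    using lst_cong_normal_form[OF assms HOL.refl] lst_cong_normal_form[OF u HOL.refl] R
    by (metis lst_cong.sym lst_cong.trans)
qed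

section \<open>Counting words with prescribed first occurrences and multiplicities\<close>

definition words_with :: "'a list \<Rightarrow> ('a \<Rightarrow> nat) \<Rightarrow> 'a list set" where
  "words_with xs m = {u. first_occs u = xs \<and> (\<forall>y\<in>set xs. count_list u y = m y)}"

lemma length_words_with:
  assumes "u \<in> words_with xs m"
  shows "length u = sum_list (map m xs)"
proof -
  have xs: "xs = first_occs u" and m: "\<forall>y\<in>set u. count_list u y = m y"
    using assms by (auto simp: words_with_def)
  have "length u = sum (count_list u) (set u)" by (simp add: sum_count_set)
  also have "\<dots> = sum m (set xs)" using m xs by simp
  also have "\<dots> = sum_list (map m xs)"
    using distinct_first_occs[of u] xs by (simp add: sum_list_distinct_conv_sum_set)
  finally show ?thesis .
qed

lemma finite_words_with: "finite (words_with xs m)"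
proof (rule finite_subset)
  show "words_with xs m \<subseteq> {u. set u \<subseteq> set xs \<and> length u = sum_list (map m xs)}"
    using length_words_with by (fastforce simp: words_with_def)
qed (rule finite_lists_length_eq, simp)

lemma words_with_Cons:
  assumes "distinct (y # xs)" "m y \<ge> 1"
  shows "words_with (y # xs) m =
    (#) y ` (\<Union>v\<in>words_with xs m. shuffles (replicate (m y - 1) y) v)"
proof (intro equalityI subsetI)
  fix u assume u: "u \<in> words_with (y # xs) m"
  then obtain u' where u': "u = y # u'" "xs = filter (\<lambda>z. z \<noteq> y) (first_occs u')"
    by (cases u) (auto simp: words_with_def)
  let ?v = "filter (\<lambda>z. z \<noteq> y) u'"
  have c: "\<And>z. z \<in> set (y # xs) \<Longrightarrow> count_list u z = m z"
    using u by (auto simp: words_with_def)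
  have "count_list ?v z = m z" if "z \<in> set xs" for z
  proof -
    have "z \<noteq> y" using that assms by auto
    then have "count_list ?v z = count_list u z"
      using u' by (simp add: count_list_filter)
    then show ?thesis using c that by simp
  qed
  then have "?v \<in> words_with xs m"
    using u' by (auto simp: words_with_def first_occs_filter)
  \<comment> \<open>One of the \<open>m y\<close> occurrences is the head of \<open>u\<close>, hence
    the \<open>m y - 1\<close>.\<close>
  moreover have "filter (\<lambda>z. z = y) u' = replicate (m y - 1) y"
    using c[of y] u' by (auto simp: filter_eq_replicate_count_list)
  then have "u' \<in> shuffles (replicate (m y - 1) y) ?v"
    using partition_in_shuffles[of u' "\<lambda>z. z = y"] by simp
  ultimately show "u \<in> (#) y ` (\<Union>v\<in>words_with xs m. shuffles (replicate (m y - 1) y) v)"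
    using u' by blast
next
  fix u assume "u \<in> (#) y ` (\<Union>v\<in>words_with xs m. shuffles (replicate (m y - 1) y) v)"
  then obtain v u' where v: "v \<in> words_with xs m" and u': "u = y # u'"
    "u' \<in> shuffles (replicate (m y - 1) y) v" by blast
  have "y \<notin> set v"
    using v assms by (auto simp: words_with_def)
  then have f: "filter (\<lambda>z. z \<noteq> y) u' = v"
    using u'(2) by (rule filter_shuffles_replicate)
  have ms: "mset u' = mset (replicate (m y - 1) y) + mset v"
    using u'(2) by (rule mset_shuffles)
  have cl: "count_list u' z = (if z = y then m y - 1 else 0) + count_list v z" for z
    using arg_cong[OF ms, of "\<lambda>M. count M z"] by (simp add: count_mset count_list_replicate)
  show "u \<in> words_with (y # xs) m"
    using v u'(1) f cl assms \<open>y \<notin> set v\<close>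
    by (auto simp: words_with_def first_occs_filter[symmetric] count_list_0_iff)
qed

lemma card_words_with_Cons:
  assumes "distinct (y # xs)" "m y \<ge> 1"
  shows "card (words_with (y # xs) m) =
    ((m y - 1 + sum_list (map m xs)) choose (m y - 1)) * card (words_with xs m)"
proof -
  let ?r = "replicate (m y - 1) y"
  have y: "y \<notin> set v" if "v \<in> words_with xs m" for v
    using that assms by (auto simp: words_with_def)
  \<comment> \<open>Deleting \<open>y\<close> from a common shuffle would give both \<open>v\<close>
    and \<open>v'\<close>.\<close>
  have disj: "shuffles ?r v \<inter> shuffles ?r v' = {}"
    if "v \<in> words_with xs m" "v' \<in> words_with xs m" "v \<noteq> v'" for v v'
    using that filter_shuffles_replicate[OF y] by blast
  have "card (words_with (y # xs) m) = card (\<Union>v\<in>words_with xs m. shuffles ?r v)"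
    by (simp add: words_with_Cons[of y xs m, OF assms] card_image)
  also have "\<dots> = (\<Sum>v\<in>words_with xs m. card (shuffles ?r v))"
    using disj by (intro card_UN_disjoint) (auto simp: finite_words_with)
  also have "\<dots> = (\<Sum>v\<in>words_with xs m. (m y - 1 + sum_list (map m xs)) choose (m y - 1))"
    using y by (intro sum.cong HOL.refl, subst card_disjoint_shuffles) (auto simp: length_words_with)
  finally show ?thesis by simp
qed

text \<open>The denominator of the formula; the sum over \<open>y # xs\<close> is the suffix sum
  starting at the current letter.\<close>

primrec hook_prod :: "'a list \<Rightarrow> ('a \<Rightarrow> nat) \<Rightarrow> nat" where
  "hook_prod [] m = 1"
| "hook_prod (y # xs) m = fact (m y - 1) * sum_list (map m (y # xs)) * hook_prod xs m"

text \<open>Stated as a product to stay within the naturals. With \<open>a = m y - 1\<close> and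
  \<open>s\<close> the number of remaining letters, the binomial coefficient times
  \<open>fact a * fact s\<close> is \<open>fact (a + s)\<close>, and the suffix sum
  \<open>Suc (a + s)\<close> raises this to the next factorial.\<close>

lemma card_words_with:
  assumes "distinct xs" "\<And>y. y \<in> set xs \<Longrightarrow> m y \<ge> 1"
  shows "card (words_with xs m) * hook_prod xs m = fact (sum_list (map m xs))"
  using assms
proof (induction xs)
  case Nil
  have "words_with [] m = {[]}" by (auto simp: words_with_def)
  then show ?case by simp
next
  case (Cons y xs)
  define a s where "a = m y - 1" and "s = sum_list (map m xs)"
  have my: "m y = Suc a" using Cons.prems(2)[of y] by (simp add: a_def)
  have IH: "card (words_with xs m) * hook_prod xs m = fact s"
    unfolding s_def using Cons by auto
  have "card (words_with (y # xs) m) * hook_prod (y # xs) m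
      = Suc (a + s) * (fact a * (card (words_with xs m) * hook_prod xs m) * ((a + s) choose a))"
    using card_words_with_Cons[OF Cons.prems(1), of m] my by (simp add: s_def algebra_simps)
  also have "\<dots> = Suc (a + s) * fact (a + s)"
    using binomial_fact_lemma[of a "a + s"] IH by simp
  finally show ?case using my by (simp add: s_def)
qed

lemma hook_prod_map_upt:
  assumes "i \<le> n"
  shows "hook_prod (map x [i..<n]) m
    = (\<Prod>l = i..<n. fact (m (x l) - 1) * (\<Sum>j = l..<n. m (x j)))"
  using assms
proof (induction rule: inc_induct)
  case (step i)
  then show ?case
    by (simp add: upt_conv_Cons prod.atLeast_Suc_lessThan sum.atLeast_Suc_lessThan
        sum_list_distinct_conv_sum_set o_def interv_sum_list_conv_sum_set_nat)
qed simp

theorem proposition5p1: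
  fixes w :: "nat list" and x :: "nat \<Rightarrow> nat" and k :: nat
  assumes "w \<in> nwords"
    and "set w = x ` {1..k}"
    and "\<And>i. 1 \<le> i \<Longrightarrow> i < k \<Longrightarrow> first_rank w (x i) < first_rank w (x (i + 1))"
  shows "real (card {u \<in> nwords. lst_cong w u}) =
    fact (length w) /
      (\<Prod>i = 1..k. fact (count_list w (x i) - 1) * (\<Sum>j = i..k. real (count_list w (x j))))"
proof -
  let ?m = "count_list w" and ?xs = "map x [1..<Suc k]"
  \<comment> \<open>The hypothesis compares only consecutive ranks; induction on \<open>j\<close>
    extends it to all pairs.\<close>
  have mono: "first_pos w (x i) < first_pos w (x j)" if "1 \<le> i" "i < j" "j \<le> k" for i j
    using that(2,3)
  proof (induction j)
    case (Suc j)
    then have "first_pos w (x j) < first_pos w (x (Suc j))"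
      using assms(3)[of j] that(1) by (intro first_pos_less_of_first_rank_less) auto
    with Suc show ?case by (cases "i = j") auto
  qed simp
  have sorted: "sorted_wrt (\<lambda>y z. first_pos w y < first_pos w z) ?xs"
    unfolding sorted_wrt_map
    by (rule sorted_wrt_mono_rel[OF _ sorted_wrt_upt]) (auto intro: mono)
  have occs: "first_occs w = ?xs"
    by (rule first_occs_eqI[OF _ sorted]) (use assms(2) in auto)
  have "w \<in> words_with ?xs ?m" using occs by (simp add: words_with_def)
  then have len: "length w = sum_list (map ?m ?xs)" by (rule length_words_with)
  have "{u \<in> nwords. lst_cong w u} = words_with ?xs ?m"
  proof -
    \<comment> \<open>The congruence relates only words in \<open>nwords\<close>, so the class is
      exactly the set counted by \<open>words_with\<close>.\<close>
    have "u \<in> nwords \<and> lst_cong w u \<longleftrightarrow> lst_cong w u" for u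
      using lst_cong_invariants by blast
    then show ?thesis
      by (simp only: lst_cong_iff[OF assms(1)] words_with_def occs)
  qed
  moreover have pos: "?m y \<ge> 1" if "y \<in> set ?xs" for y
    using that assms(2) count_list_0_iff[of w y] by (fastforce simp: Suc_le_eq)
  then have card: "card (words_with ?xs ?m) * hook_prod ?xs ?m = fact (length w)"
    unfolding len using distinct_first_occs[of w] occs by (intro card_words_with) auto
  \<comment> \<open>A factor of a factorial cannot vanish, so the product identity may be divided in
    the reals.\<close>
  then have "hook_prod ?xs ?m \<noteq> 0" by (metis fact_nonzero mult_0_right)
  then have "real (card (words_with ?xs ?m)) = fact (length w) / real (hook_prod ?xs ?m)"
    using arg_cong[OF card, of real] by (simp add: field_simps)
  moreover have "real (hook_prod ?xs ?m) =
      (\<Prod>i = 1..k. fact (?m (x i) - 1) * (\<Sum>j = i..k. real (?m (x j))))"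
    using hook_prod_map_upt[of 1 "Suc k" x ?m] by (simp add: atLeastLessThanSuc_atLeastAtMost)
  ultimately show ?thesis by simp
qed

end
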